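(* Let $\mathsf{C}$ and $\mathsf{D}$ be categories with limits (resp. colimits) and let $\mathsf{T}$ be any time category. If $K \colon \mathsf{C} \to \mathsf{D}$ is a continuous (resp. cocontinuous) functor, then composition with $K$ determines a functor $(K \circ -)$ from persistent (resp. cumulative) $\mathsf{C}$-narratives to persistent (resp. cumulative) $\mathsf{D}$-narratives. Explicitly, for persistent narratives, there is a functor $$(K \circ -) \colon \mathsf{Pe}(\mathsf{T}, \mathsf{C}) \to \mathsf{Pe}(\mathsf{T}, \mathsf{D}), \qquad (F \colon \mathsf{T}^{op} \to \mathsf{C}) \mapsto (K \circ F \colon \mathsf{T}^{op} \to \mathsf{D}),$$ and, for cumulative narratives, there is a functor $$(K \circ -) \colon \mathsf{Cu}(\mathsf{T}, \mathsf{C}) \to \mathsf{Cu}(\mathsf{T}, \mathsf{D}), \qquad (F \colon \mathsf{T} \to \mathsf{C}) \mapsto (K \circ F \colon \mathsf{T} \to \mathsf{D}).$$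
   Context: Let $\mathsf{I}$ (resp. $\mathsf{I}_{\mathbb{N}}$) be the poset, regarded as a category, whose objects are the closed intervals $[a,b]$ ($a \le b$) of $\mathbb{R}$ (resp. of $\mathbb{N}$) and whose morphisms are the inclusions of intervals. It is a join-semilattice: the join of two intervals is the smallest closed interval containing both. A time category is any sub-join-semilattice $\mathsf{T}$ of $\mathsf{I}$ or of $\mathsf{I}_{\mathbb{N}}$, regarded as a posetal category. A cover of an interval $[a,b]$ is a pair $([a,p],[p,b])$ with $a \le p \le b$; for $\mathsf{T}$, one considers those covers for which $[a,b],[a,p],[p,b],[p,p]$ are objects of $\mathsf{T}$. For a category $\mathsf{D}$ with pullbacks, a $\mathsf{D}$-valued sheaf on $\mathsf{T}$ is a functor $F \colon \mathsf{T}^{op} \to \mathsf{D}$ such that for every interval $[a,b]$ and every cover $([a,p],[p,b])$ of it, $F([a,b])$ (with the restriction maps) is the pullback $F([a,p]) \times_{F([p,p])} F([p,b])$. For a category $\mathsf{D}$ with pushouts, a $\mathsf{D}$-valued cosheaf on $\mathsf{T}$ is a functor $\hat{F} \colon \mathsf{T} \to \mathsf{D}$ such that for every interval $[a,b]$ and every cover $([a,p],[p,b])$ of it, $\hat{F}([a,b])$ is the pushout $\hat{F}([a,p]) +_{\hat{F}([p,p])} \hat{F}([p,b])$. $\mathsf{Pe}(\mathsf{T},\mathsf{D})$ denotes the category of $\mathsf{D}$-valued sheaves on $\mathsf{T}$ (persistent $\mathsf{D}$-narratives) and $\mathsf{Cu}(\mathsf{T},\mathsf{D})$ the category of $\mathsf{D}$-valued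 cosheaves on $\mathsf{T}$ (cumulative $\mathsf{D}$-narratives); in both cases morphisms are natural transformations. Continuous (resp. cocontinuous) means preserving limits (resp. colimits). *)

theory Defs
  imports Complex_Main "HOL-Library.FuncSet" "HOL-Library.Infinite_Typeclass"
begin

text \<open>\<open>Comp C g f\<close> is the composite \<open>g \<circ> f\<close>; it is only meaningful when \<open>Cod C f = Dom C g\<close>.\<close>

record ('o, 'm) cat =
  Obj :: "'o set"
  Arr :: "'m set"
  Dom :: "'m \<Rightarrow> 'o"
  Cod :: "'m \<Rightarrow> 'o"
  Idt :: "'o \<Rightarrow> 'm"
  Comp :: "'m \<Rightarrow> 'm \<Rightarrow> 'm"

definition hom :: "('o, 'm) cat \<Rightarrow> 'o \<Rightarrow> 'o \<Rightarrow> 'm set" where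
  "hom C x y = {f \<in> Arr C. Dom C f = x \<and> Cod C f = y}"

definition is_category :: "('o, 'm) cat \<Rightarrow> bool" where
  "is_category C \<longleftrightarrow>
     (\<forall>f\<in>Arr C. Dom C f \<in> Obj C \<and> Cod C f \<in> Obj C) \<and>
     (\<forall>x\<in>Obj C. Idt C x \<in> hom C x x) \<and>
     (\<forall>f\<in>Arr C. \<forall>g\<in>Arr C. Cod C f = Dom C g \<longrightarrow> Comp C g f \<in> hom C (Dom C f) (Cod C g)) \<and>
     (\<forall>f\<in>Arr C. Comp C f (Idt C (Dom C f)) = f \<and> Comp C (Idt C (Cod C f)) f = f) \<and>
     (\<forall>f\<in>Arr C. \<forall>g\<in>Arr C. \<forall>h\<in>Arr C. Cod C f = Dom C g \<longrightarrow> Cod C g = Dom C h \<longrightarrow>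
        Comp C h (Comp C g f) = Comp C (Comp C h g) f)"

definition op_cat :: "('o, 'm) cat \<Rightarrow> ('o, 'm) cat" where
  "op_cat C = \<lparr>Obj = Obj C, Arr = Arr C, Dom = Cod C, Cod = Dom C, Idt = Idt C,
               Comp = (\<lambda>g f. Comp C f g)\<rparr>"

definition poset_cat :: "'a set set \<Rightarrow> ('a set, 'a set \<times> 'a set) cat" where
  "poset_cat T = \<lparr>Obj = T, Arr = {(X, Y). X \<in> T \<and> Y \<in> T \<and> X \<subseteq> Y},
                  Dom = fst, Cod = snd, Idt = (\<lambda>X. (X, X)),
                  Comp = (\<lambda>g f. (fst f, snd g))\<rparr>"

record ('o1, 'm1, 'o2, 'm2) functr =
  fobj :: "'o1 \<Rightarrow> 'o2"
  farr :: "'m1 \<Rightarrow> 'm2"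

text \<open>Functors and the components of natural transformations are required to be extensional
  (i.e. \<open>undefined\<close> off their domain), so that equality in HOL is equality of functors and of
  natural transformations.\<close>

definition is_functor ::
  "('o1, 'm1) cat \<Rightarrow> ('o2, 'm2) cat \<Rightarrow> ('o1, 'm1, 'o2, 'm2) functr \<Rightarrow> bool" where
  "is_functor C D F \<longleftrightarrow>
     is_category C \<and> is_category D \<and>
     fobj F \<in> Obj C \<rightarrow>\<^sub>E Obj D \<and>
     farr F \<in> Arr C \<rightarrow>\<^sub>E Arr D \<and>
     (\<forall>f\<in>Arr C. farr F f \<in> hom D (fobj F (Dom C f)) (fobj F (Cod C f))) \<and>
     (\<forall>x\<in>Obj C. farr F (Idt C x) = Idt D (fobj F x)) \<and>
     (\<forall>f\<in>Arr C. \<forall>g\<in>Arr C. Cod C f = Dom C g \<longrightarrow>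
        farr F (Comp C g f) = Comp D (farr F g) (farr F f))"

text \<open>The composite \<open>K \<circ> F\<close>, where \<open>J\<close> is the source category of \<open>F\<close>.\<close>

definition comp_functor ::
  "('oj, 'mj) cat \<Rightarrow> ('oc, 'mc, 'od, 'md) functr \<Rightarrow> ('oj, 'mj, 'oc, 'mc) functr
   \<Rightarrow> ('oj, 'mj, 'od, 'md) functr" where
  "comp_functor J K F = \<lparr>fobj = (\<lambda>x\<in>Obj J. fobj K (fobj F x)),
                         farr = (\<lambda>f\<in>Arr J. farr K (farr F f))\<rparr>"

record ('oj, 'mj, 'oc, 'mc) nat_trans =
  Src :: "('oj, 'mj, 'oc, 'mc) functr"
  Tgt :: "('oj, 'mj, 'oc, 'mc) functr"
  Cmpt :: "'oj \<Rightarrow> 'mc"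

definition is_nat_trans ::
  "('oj, 'mj) cat \<Rightarrow> ('oc, 'mc) cat \<Rightarrow> ('oj, 'mj, 'oc, 'mc) nat_trans \<Rightarrow> bool" where
  "is_nat_trans J C \<eta> \<longleftrightarrow>
     is_functor J C (Src \<eta>) \<and> is_functor J C (Tgt \<eta>) \<and>
     Cmpt \<eta> \<in> extensional (Obj J) \<and>
     (\<forall>x\<in>Obj J. Cmpt \<eta> x \<in> hom C (fobj (Src \<eta>) x) (fobj (Tgt \<eta>) x)) \<and>
     (\<forall>f\<in>Arr J. Comp C (farr (Tgt \<eta>) f) (Cmpt \<eta> (Dom J f)) =
                 Comp C (Cmpt \<eta> (Cod J f)) (farr (Src \<eta>) f))"

text \<open>Full subcategory of the functor category \<open>[J, C]\<close> on the functors satisfying \<open>P\<close>.\<close>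

definition functor_cat ::
  "('oj, 'mj) cat \<Rightarrow> ('oc, 'mc) cat \<Rightarrow> (('oj, 'mj, 'oc, 'mc) functr \<Rightarrow> bool) \<Rightarrow>
   (('oj, 'mj, 'oc, 'mc) functr, ('oj, 'mj, 'oc, 'mc) nat_trans) cat" where
  "functor_cat J C P =
     \<lparr>Obj = {F. is_functor J C F \<and> P F},
      Arr = {\<eta>. is_nat_trans J C \<eta> \<and> P (Src \<eta>) \<and> P (Tgt \<eta>)},
      Dom = Src, Cod = Tgt,
      Idt = (\<lambda>F. \<lparr>Src = F, Tgt = F, Cmpt = (\<lambda>x\<in>Obj J. Idt C (fobj F x))\<rparr>),
      Comp = (\<lambda>\<theta> \<eta>. \<lparr>Src = Src \<eta>, Tgt = Tgt \<theta>,
                       Cmpt = (\<lambda>x\<in>Obj J. Comp C (Cmpt \<theta> x) (Cmpt \<eta> x))\<rparr>)\<rparr>"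

definition cone ::
  "('oj, 'mj) cat \<Rightarrow> ('oc, 'mc) cat \<Rightarrow> ('oj, 'mj, 'oc, 'mc) functr \<Rightarrow> 'oc \<Rightarrow> ('oj \<Rightarrow> 'mc) \<Rightarrow> bool"
  where
  "cone J C G c l \<longleftrightarrow> c \<in> Obj C \<and>
     (\<forall>j\<in>Obj J. l j \<in> hom C c (fobj G j)) \<and>
     (\<forall>f\<in>Arr J. Comp C (farr G f) (l (Dom J f)) = l (Cod J f))"

definition limit_cone ::
  "('oj, 'mj) cat \<Rightarrow> ('oc, 'mc) cat \<Rightarrow> ('oj, 'mj, 'oc, 'mc) functr \<Rightarrow> 'oc \<Rightarrow> ('oj \<Rightarrow> 'mc) \<Rightarrow> bool"
  where
  "limit_cone J C G c l \<longleftrightarrow> cone J C G c l \<and>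
     (\<forall>x k. cone J C G x k \<longrightarrow> (\<exists>!h. h \<in> hom C x c \<and> (\<forall>j\<in>Obj J. Comp C (l j) h = k j)))"

definition cocone ::
  "('oj, 'mj) cat \<Rightarrow> ('oc, 'mc) cat \<Rightarrow> ('oj, 'mj, 'oc, 'mc) functr \<Rightarrow> 'oc \<Rightarrow> ('oj \<Rightarrow> 'mc) \<Rightarrow> bool"
  where
  "cocone J C G c l \<longleftrightarrow> c \<in> Obj C \<and>
     (\<forall>j\<in>Obj J. l j \<in> hom C (fobj G j) c) \<and>
     (\<forall>f\<in>Arr J. Comp C (l (Cod J f)) (farr G f) = l (Dom J f))"

definition colimit_cocone ::
  "('oj, 'mj) cat \<Rightarrow> ('oc, 'mc) cat \<Rightarrow> ('oj, 'mj, 'oc, 'mc) functr \<Rightarrow> 'oc \<Rightarrow> ('oj \<Rightarrow> 'mc) \<Rightarrow> bool"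
  where
  "colimit_cocone J C G c l \<longleftrightarrow> cocone J C G c l \<and>
     (\<forall>x k. cocone J C G x k \<longrightarrow> (\<exists>!h. h \<in> hom C c x \<and> (\<forall>j\<in>Obj J. Comp C h (l j) = k j)))"

text \<open>Limits are taken over all small diagrams. The infinite type \<open>'u\<close> plays the role of the
  universe: a category is small if its objects and its arrows can be indexed by elements
  of \<open>'u\<close>. No relation between \<open>'u\<close> and the types of objects and arrows of \<open>C\<close> is imposed, and
  the diagrams indexed by finite categories are always among the small ones.\<close>

definition has_limits :: "'u::infinite itself \<Rightarrow> ('oc, 'mc) cat \<Rightarrow> bool" where
  "has_limits _ C \<longleftrightarrow>
     (\<forall>(J :: ('u, 'u) cat) G. is_functor J C G \<longrightarrow> (\<exists>c l. limit_cone J C G c l))"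

definition has_colimits :: "'u::infinite itself \<Rightarrow> ('oc, 'mc) cat \<Rightarrow> bool" where
  "has_colimits _ C \<longleftrightarrow>
     (\<forall>(J :: ('u, 'u) cat) G. is_functor J C G \<longrightarrow> (\<exists>c l. colimit_cocone J C G c l))"

definition continuous_functor ::
  "'u::infinite itself \<Rightarrow> ('oc, 'mc) cat \<Rightarrow> ('od, 'md) cat \<Rightarrow> ('oc, 'mc, 'od, 'md) functr \<Rightarrow> bool"
  where
  "continuous_functor _ C D K \<longleftrightarrow> is_functor C D K \<and>
     (\<forall>(J :: ('u, 'u) cat) G c l. is_functor J C G \<longrightarrow> limit_cone J C G c l \<longrightarrow>
        limit_cone J D (comp_functor J K G) (fobj K c) (\<lambda>j. farr K (l j)))"

definition cocontinuous_functor ::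
  "'u::infinite itself \<Rightarrow> ('oc, 'mc) cat \<Rightarrow> ('od, 'md) cat \<Rightarrow> ('oc, 'mc, 'od, 'md) functr \<Rightarrow> bool"
  where
  "cocontinuous_functor _ C D K \<longleftrightarrow> is_functor C D K \<and>
     (\<forall>(J :: ('u, 'u) cat) G c l. is_functor J C G \<longrightarrow> colimit_cocone J C G c l \<longrightarrow>
        colimit_cocone J D (comp_functor J K G) (fobj K c) (\<lambda>j. farr K (l j)))"

text \<open>\<open>is_pullback C p q f g\<close>: the projections \<open>p, q\<close> exhibit their common domain as the
  pullback of \<open>f\<close> (after \<open>p\<close>) and \<open>g\<close> (after \<open>q\<close>).\<close>

definition is_pullback :: "('o, 'm) cat \<Rightarrow> 'm \<Rightarrow> 'm \<Rightarrow> 'm \<Rightarrow> 'm \<Rightarrow> bool" where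
  "is_pullback C p q f g \<longleftrightarrow>
     p \<in> Arr C \<and> q \<in> Arr C \<and> f \<in> Arr C \<and> g \<in> Arr C \<and>
     Dom C p = Dom C q \<and> Cod C p = Dom C f \<and> Cod C q = Dom C g \<and> Cod C f = Cod C g \<and>
     Comp C f p = Comp C g q \<and>
     (\<forall>x\<in>Obj C. \<forall>p' \<in> hom C x (Dom C f). \<forall>q' \<in> hom C x (Dom C g).
        Comp C f p' = Comp C g q' \<longrightarrow>
        (\<exists>!h. h \<in> hom C x (Dom C p) \<and> Comp C p h = p' \<and> Comp C q h = q'))"

text \<open>\<open>is_pushout C i j f g\<close>: the coprojections \<open>i, j\<close> exhibit their common codomain as the
  pushout of \<open>f\<close> (before \<open>i\<close>) and \<open>g\<close> (before \<open>j\<close>).\<close>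

definition is_pushout :: "('o, 'm) cat \<Rightarrow> 'm \<Rightarrow> 'm \<Rightarrow> 'm \<Rightarrow> 'm \<Rightarrow> bool" where
  "is_pushout C i j f g \<longleftrightarrow>
     i \<in> Arr C \<and> j \<in> Arr C \<and> f \<in> Arr C \<and> g \<in> Arr C \<and>
     Cod C i = Cod C j \<and> Dom C i = Cod C f \<and> Dom C j = Cod C g \<and> Dom C f = Dom C g \<and>
     Comp C i f = Comp C j g \<and>
     (\<forall>x\<in>Obj C. \<forall>i' \<in> hom C (Cod C f) x. \<forall>j' \<in> hom C (Cod C g) x.
        Comp C i' f = Comp C j' g \<longrightarrow>
        (\<exists>!h. h \<in> hom C (Cod C i) x \<and> Comp C h i = i' \<and> Comp C h j = j'))"

text \<open>The time line \<open>A\<close> is either \<open>UNIV\<close>, the reals, or \<open>\<nat>\<close>, the natural numbers as a subset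
  of the reals. For \<open>a, b \<in> A\<close> the closed interval \<open>[a, b]\<close> of \<open>A\<close> is the following set.\<close>

definition ivl :: "real set \<Rightarrow> real \<Rightarrow> real \<Rightarrow> real set" where
  "ivl A a b = {x \<in> A. a \<le> x \<and> x \<le> b}"

definition intervals :: "real set \<Rightarrow> real set set" where
  "intervals A = {ivl A a b | a b. a \<in> A \<and> b \<in> A \<and> a \<le> b}"

definition is_join :: "real set \<Rightarrow> real set \<Rightarrow> real set \<Rightarrow> real set \<Rightarrow> bool" where
  "is_join A X Y Z \<longleftrightarrow> Z \<in> intervals A \<and> X \<subseteq> Z \<and> Y \<subseteq> Z \<and>
     (\<forall>W\<in>intervals A. X \<subseteq> W \<longrightarrow> Y \<subseteq> W \<longrightarrow> Z \<subseteq> W)"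

definition time_category :: "real set \<Rightarrow> real set set \<Rightarrow> bool" where
  "time_category A T \<longleftrightarrow> (A = UNIV \<or> A = \<nat>) \<and> T \<subseteq> intervals A \<and>
     (\<forall>X\<in>T. \<forall>Y\<in>T. \<forall>Z. is_join A X Y Z \<longrightarrow> Z \<in> T)"

definition cover :: "real set \<Rightarrow> real set set \<Rightarrow> real \<Rightarrow> real \<Rightarrow> real \<Rightarrow> bool" where
  "cover A T a p b \<longleftrightarrow> a \<in> A \<and> p \<in> A \<and> b \<in> A \<and> a \<le> p \<and> p \<le> b \<and>
     ivl A a b \<in> T \<and> ivl A a p \<in> T \<and> ivl A p b \<in> T \<and> ivl A p p \<in> T"

text \<open>The pair \<open>(X, Y)\<close> with \<open>X \<subseteq> Y\<close> is an arrow from \<open>X\<close> to \<open>Y\<close> in \<open>poset_cat T\<close>, and from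
  \<open>Y\<close> to \<open>X\<close> in \<open>op_cat (poset_cat T)\<close>; a contravariant functor sends it to the restriction map.\<close>

definition is_sheaf :: "real set \<Rightarrow> real set set \<Rightarrow> ('o, 'm) cat \<Rightarrow>
  (real set, real set \<times> real set, 'o, 'm) functr \<Rightarrow> bool" where
  "is_sheaf A T D F \<longleftrightarrow> is_functor (op_cat (poset_cat T)) D F \<and>
     (\<forall>a p b. cover A T a p b \<longrightarrow>
        is_pullback D (farr F (ivl A a p, ivl A a b)) (farr F (ivl A p b, ivl A a b))
                      (farr F (ivl A p p, ivl A a p)) (farr F (ivl A p p, ivl A p b)))"

definition is_cosheaf :: "real set \<Rightarrow> real set set \<Rightarrow> ('o, 'm) cat \<Rightarrow>
  (real set, real set \<times> real set, 'o, 'm) functr \<Rightarrow> bool" where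
  "is_cosheaf A T D F \<longleftrightarrow> is_functor (poset_cat T) D F \<and>
     (\<forall>a p b. cover A T a p b \<longrightarrow>
        is_pushout D (farr F (ivl A a p, ivl A a b)) (farr F (ivl A p b, ivl A a b))
                     (farr F (ivl A p p, ivl A a p)) (farr F (ivl A p p, ivl A p b)))"

definition Pe where
  "Pe A T D = functor_cat (op_cat (poset_cat T)) D (is_sheaf A T D)"

definition Cu where
  "Cu A T D = functor_cat (poset_cat T) D (is_cosheaf A T D)"

text \<open>Post-composition with \<open>K\<close> on a category \<open>N\<close> of functors with source \<open>J\<close>: it sends a
  functor \<open>F\<close> to \<open>K \<circ> F\<close> and a natural transformation \<open>\<eta>\<close> to the whiskering \<open>K \<eta>\<close>.\<close>

definition postcomp ::
  "('oj, 'mj) cat \<Rightarrow> ('oc, 'mc, 'od, 'md) functr \<Rightarrow>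
   (('oj, 'mj, 'oc, 'mc) functr, ('oj, 'mj, 'oc, 'mc) nat_trans) cat \<Rightarrow>
   (('oj, 'mj, 'oc, 'mc) functr, ('oj, 'mj, 'oc, 'mc) nat_trans,
    ('oj, 'mj, 'od, 'md) functr, ('oj, 'mj, 'od, 'md) nat_trans) functr" where
  "postcomp J K N =
     \<lparr>fobj = (\<lambda>F\<in>Obj N. comp_functor J K F),
      farr = (\<lambda>\<eta>\<in>Arr N. \<lparr>Src = comp_functor J K (Src \<eta>), Tgt = comp_functor J K (Tgt \<eta>),
                          Cmpt = (\<lambda>x\<in>Obj J. farr K (Cmpt \<eta> x))\<rparr>)\<rparr>"

end

theory Submission
  imports Defs
begin

text \<open>A sheaf condition only asks certain squares to be pullbacks, and a continuous functor
  preserves pullbacks because these are the limits over the cospan category, which, having five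
  arrows, embeds into any infinite universe. Cosheaves are handled by duality: a pushout in \<open>C\<close>
  is a pullback in the opposite of \<open>C\<close>. The rest is whiskering of natural transformations.\<close>

section \<open>Functor categories and whiskering\<close>

lemma category_Dom: "is_category C \<Longrightarrow> f \<in> Arr C \<Longrightarrow> Dom C f \<in> Obj C"
  and category_Cod: "is_category C \<Longrightarrow> f \<in> Arr C \<Longrightarrow> Cod C f \<in> Obj C"
  and category_Idt: "is_category C \<Longrightarrow> x \<in> Obj C \<Longrightarrow> Idt C x \<in> hom C x x"
  and category_Comp_Idt: "is_category C \<Longrightarrow> f \<in> hom C x y \<Longrightarrow> Comp C f (Idt C x) = f"
  and category_Idt_Comp: "is_category C \<Longrightarrow> f \<in> hom C x y \<Longrightarrow> Comp C (Idt C y) f = f"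
  by (auto simp: is_category_def hom_def)

text \<open>Typing arrows by \<open>hom\<close> lets unification match the intermediate objects, so
  later proofs never show composability as a separate equation between \<open>Cod\<close> and
  \<open>Dom\<close>.\<close>

lemma category_Comp:
  "is_category C \<Longrightarrow> f \<in> hom C x y \<Longrightarrow> g \<in> hom C y z \<Longrightarrow> Comp C g f \<in> hom C x z"
  unfolding is_category_def by (auto simp: hom_def)

lemma category_assoc:
  "is_category C \<Longrightarrow> f \<in> hom C w x \<Longrightarrow> g \<in> hom C x y \<Longrightarrow> h \<in> hom C y z \<Longrightarrow>
    Comp C h (Comp C g f) = Comp C (Comp C h g) f"
  unfolding is_category_def by (auto simp: hom_def)

lemma functor_fobj: "is_functor C D F \<Longrightarrow> x \<in> Obj C \<Longrightarrow> fobj F x \<in> Obj D"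
  and functor_farr:
    "is_functor C D F \<Longrightarrow> f \<in> hom C x y \<Longrightarrow> farr F f \<in> hom D (fobj F x) (fobj F y)"
  and functor_Idt: "is_functor C D F \<Longrightarrow> x \<in> Obj C \<Longrightarrow> farr F (Idt C x) = Idt D (fobj F x)"
  by (auto simp: is_functor_def hom_def)

lemma functor_Comp:
  "is_functor C D F \<Longrightarrow> f \<in> hom C x y \<Longrightarrow> g \<in> hom C y z \<Longrightarrow>
    farr F (Comp C g f) = Comp D (farr F g) (farr F f)"
  by (auto simp: is_functor_def hom_def)

lemma Arr_hom: "f \<in> Arr C \<Longrightarrow> f \<in> hom C (Dom C f) (Cod C f)"
  by (simp add: hom_def)

lemma nat_trans_Cmpt:
  "is_nat_trans J C \<eta> \<Longrightarrow> x \<in> Obj J \<Longrightarrow> Cmpt \<eta> x \<in> hom C (fobj (Src \<eta>) x) (fobj (Tgt \<eta>) x)"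
  and nat_trans_natural:
  "is_nat_trans J C \<eta> \<Longrightarrow> f \<in> hom J x y \<Longrightarrow>
    Comp C (farr (Tgt \<eta>) f) (Cmpt \<eta> x) = Comp C (Cmpt \<eta> y) (farr (Src \<eta>) f)"
  by (auto simp: is_nat_trans_def hom_def)

section \<open>Identities and composites of natural transformations; the functor category\<close>

lemma is_nat_trans_Idt:
  assumes "is_functor J C F"
  shows "is_nat_trans J C \<lparr>Src = F, Tgt = F, Cmpt = (\<lambda>x\<in>Obj J. Idt C (fobj F x))\<rparr>"
proof -
  have J: "is_category J" and C: "is_category C"
    using assms by (auto simp: is_functor_def)
  have "Comp C (farr F f) (Idt C (fobj F (Dom J f))) = Comp C (Idt C (fobj F (Cod J f))) (farr F f)"
    if "f \<in> Arr J" for f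
    using functor_farr[OF assms Arr_hom[OF that]] C
    by (simp add: category_Comp_Idt category_Idt_Comp)
  then show ?thesis
    using assms J C by (simp add: is_nat_trans_def category_Dom category_Cod category_Idt functor_fobj)
qed

text \<open>Pasting two naturality squares side by side gives a naturality square: by associativity
  the image of \<open>f\<close> moves first past \<theta> and then past \<eta>.\<close>

lemma is_nat_trans_Comp:
  assumes e: "is_nat_trans J C \<eta>" and t: "is_nat_trans J C \<theta>" and eq: "Tgt \<eta> = Src \<theta>"
  shows "is_nat_trans J C \<lparr>Src = Src \<eta>, Tgt = Tgt \<theta>,
           Cmpt = (\<lambda>x\<in>Obj J. Comp C (Cmpt \<theta> x) (Cmpt \<eta> x))\<rparr>"
proof -
  have FS: "is_functor J C (Src \<eta>)" and FM: "is_functor J C (Src \<theta>)" and FT: "is_functor J C (Tgt \<theta>)"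
    using e t by (auto simp: is_nat_trans_def)
  then have J: "is_category J" and C: "is_category C"
    by (auto simp: is_functor_def)
  have "Comp C (farr (Tgt \<theta>) f) (Comp C (Cmpt \<theta> (Dom J f)) (Cmpt \<eta> (Dom J f))) =
        Comp C (Comp C (Cmpt \<theta> (Cod J f)) (Cmpt \<eta> (Cod J f))) (farr (Src \<eta>) f)"
    if f: "f \<in> Arr J" for f
  proof -
    note f' = Arr_hom[OF f]
    have x: "Dom J f \<in> Obj J" and y: "Cod J f \<in> Obj J"
      using f J by (auto simp: category_Dom category_Cod)
    \<comment> \<open>Rewriting with \<open>eq\<close> makes the components of \<eta> end where
      those of \<theta> start.\<close>
    note ex = nat_trans_Cmpt[OF e x, unfolded eq] and ey = nat_trans_Cmpt[OF e y, unfolded eq]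
    note tx = nat_trans_Cmpt[OF t x] and ty = nat_trans_Cmpt[OF t y]
    note fs = functor_farr[OF FS f'] and fm = functor_farr[OF FM f'] and ft = functor_farr[OF FT f']
    have "Comp C (farr (Tgt \<theta>) f) (Comp C (Cmpt \<theta> (Dom J f)) (Cmpt \<eta> (Dom J f))) =
          Comp C (Comp C (Cmpt \<theta> (Cod J f)) (farr (Src \<theta>) f)) (Cmpt \<eta> (Dom J f))"
      by (simp add: category_assoc[OF C ex tx ft] nat_trans_natural[OF t f'])
    also have "\<dots> = Comp C (Cmpt \<theta> (Cod J f)) (Comp C (Cmpt \<eta> (Cod J f)) (farr (Src \<eta>) f))"
      using nat_trans_natural[OF e f'] by (simp add: category_assoc[OF C ex fm ty, symmetric] eq)
    finally show ?thesis
      by (simp add: category_assoc[OF C fs ey ty])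
  qed
  moreover have "Comp C (Cmpt \<theta> x) (Cmpt \<eta> x) \<in> hom C (fobj (Src \<eta>) x) (fobj (Tgt \<theta>) x)"
    if "x \<in> Obj J" for x
    using category_Comp[OF C nat_trans_Cmpt[OF e that, unfolded eq] nat_trans_Cmpt[OF t that]] .
  ultimately show ?thesis
    using FS FT J by (simp add: is_nat_trans_def category_Dom category_Cod)
qed

lemma nat_trans_eqI:
  fixes \<eta> \<theta> :: "('oj, 'mj, 'oc, 'mc) nat_trans"
  assumes "Src \<eta> = Src \<theta>" "Tgt \<eta> = Tgt \<theta>"
    and "Cmpt \<eta> \<in> extensional X" "Cmpt \<theta> \<in> extensional X" "\<And>x. x \<in> X \<Longrightarrow> Cmpt \<eta> x = Cmpt \<theta> x"
  shows "\<eta> = \<theta>"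
  using assms by (intro nat_trans.equality) (auto intro: extensionalityI)

text \<open>The laws hold at each object of \<open>J\<close> because they hold in \<open>C\<close>.
  \<open>P\<close> can be arbitrary since the subcategory is full: identities and composites take
  their sources and targets from functors already known to satisfy \<open>P\<close>.\<close>

lemma is_category_functor_cat:
  assumes J: "is_category J" and C: "is_category C"
  shows "is_category (functor_cat J C P)"
proof -
  let ?N = "functor_cat J C P"
  have unit: "Comp ?N \<eta> (Idt ?N (Dom ?N \<eta>)) = \<eta> \<and> Comp ?N (Idt ?N (Cod ?N \<eta>)) \<eta> = \<eta>"
    if "\<eta> \<in> Arr ?N" for \<eta>
  proof -
    have e: "is_nat_trans J C \<eta>" using that by (simp add: functor_cat_def)
    \<comment> \<open>Composition restricts components to \<open>Obj J\<close>, so a composite with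
      an identity is \<eta> itself only because \<eta> is already \<open>undefined\<close> outside
      \<open>Obj J\<close>.\<close>
    have ext: "Cmpt \<eta> \<in> extensional (Obj J)" using e by (simp add: is_nat_trans_def)
    have "Comp C (Cmpt \<eta> x) (Idt C (fobj (Src \<eta>) x)) = Cmpt \<eta> x"
      "Comp C (Idt C (fobj (Tgt \<eta>) x)) (Cmpt \<eta> x) = Cmpt \<eta> x" if "x \<in> Obj J" for x
      using category_Comp_Idt[OF C nat_trans_Cmpt[OF e that]]
        category_Idt_Comp[OF C nat_trans_Cmpt[OF e that]] .
    then show ?thesis
      using ext by (auto simp: functor_cat_def intro!: nat_trans_eqI[where X = "Obj J"])
  qed
  have assoc: "Comp ?N \<zeta> (Comp ?N \<theta> \<eta>) = Comp ?N (Comp ?N \<zeta> \<theta>) \<eta>"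
    if "\<eta> \<in> Arr ?N" "\<theta> \<in> Arr ?N" "\<zeta> \<in> Arr ?N" "Cod ?N \<eta> = Dom ?N \<theta>" "Cod ?N \<theta> = Dom ?N \<zeta>"
    for \<eta> \<theta> \<zeta>
  proof -
    have *: "is_nat_trans J C \<eta>" "is_nat_trans J C \<theta>" "is_nat_trans J C \<zeta>"
      "Tgt \<eta> = Src \<theta>" "Tgt \<theta> = Src \<zeta>"
      using that by (auto simp: functor_cat_def)
    have "Comp C (Cmpt \<zeta> x) (Comp C (Cmpt \<theta> x) (Cmpt \<eta> x)) =
          Comp C (Comp C (Cmpt \<zeta> x) (Cmpt \<theta> x)) (Cmpt \<eta> x)" if "x \<in> Obj J" for x
      using nat_trans_Cmpt[OF *(1) that] nat_trans_Cmpt[OF *(2) that] nat_trans_Cmpt[OF *(3) that]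
        *(4,5) by (intro category_assoc[OF C]) auto
    then show ?thesis
      by (auto simp: functor_cat_def intro!: restrict_ext)
  qed
  have dom_cod: "Dom ?N \<eta> \<in> Obj ?N \<and> Cod ?N \<eta> \<in> Obj ?N" if "\<eta> \<in> Arr ?N" for \<eta>
    using that by (auto simp: functor_cat_def is_nat_trans_def)
  have idt: "Idt ?N F \<in> hom ?N F F" if "F \<in> Obj ?N" for F
    using that by (auto simp: functor_cat_def hom_def is_nat_trans_Idt)
  have comp: "Comp ?N \<theta> \<eta> \<in> hom ?N (Dom ?N \<eta>) (Cod ?N \<theta>)"
    if "\<eta> \<in> Arr ?N" "\<theta> \<in> Arr ?N" "Cod ?N \<eta> = Dom ?N \<theta>" for \<eta> \<theta>
    using that by (auto simp: functor_cat_def hom_def is_nat_trans_Comp)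
  show ?thesis
    unfolding is_category_def using unit assoc dom_cod idt comp by blast
qed

section \<open>Whiskering and post-composition\<close>

lemma is_functor_comp_functor:
  assumes K: "is_functor C D K" and F: "is_functor J C F"
  shows "is_functor J D (comp_functor J K F)"
proof -
  have J: "is_category J" and D: "is_category D"
    using assms by (auto simp: is_functor_def)
  have farr: "farr K (farr F f) \<in> hom D (fobj K (fobj F (Dom J f))) (fobj K (fobj F (Cod J f)))"
    if "f \<in> Arr J" for f
    using functor_farr[OF K functor_farr[OF F Arr_hom[OF that]]] .
  \<comment> \<open>The arrow map of \<open>comp_functor\<close> is restricted to
    \<open>Arr J\<close>; evaluating it at an identity or a composite requires that arrow to lie
    there.\<close>
  have idt: "Idt J x \<in> Arr J" if "x \<in> Obj J" for x
    using category_Idt[OF J that] by (simp add: hom_def)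
  have comp: "Comp J g f \<in> Arr J \<and>
      farr K (farr F (Comp J g f)) = Comp D (farr K (farr F g)) (farr K (farr F f))"
    if "f \<in> Arr J" "g \<in> Arr J" "Cod J f = Dom J g" for f g
  proof -
    have f: "f \<in> hom J (Dom J f) (Dom J g)" and g: "g \<in> hom J (Dom J g) (Cod J g)"
      using that by (auto simp: hom_def)
    show ?thesis
      using category_Comp[OF J f g] functor_Comp[OF F f g]
        functor_Comp[OF K functor_farr[OF F f] functor_farr[OF F g]] by (simp add: hom_def)
  qed
  have arr: "farr K (farr F f) \<in> Arr D" if "f \<in> Arr J" for f
    using farr[OF that] by (simp add: hom_def)
  show ?thesis
    unfolding is_functor_def comp_functor_def
    using J D farr idt comp arr functor_fobj[OF F] functor_fobj[OF K] functor_Idt[OF F] functor_Idt[OF K]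
    by (auto simp: category_Dom category_Cod)
qed

text \<open>A functor preserves commuting squares, so \<open>K\<close> carries each naturality
  square of \<eta> to one of the whiskering.\<close>

lemma is_nat_trans_whisker:
  assumes K: "is_functor C D K" and e: "is_nat_trans J C \<eta>"
  shows "is_nat_trans J D \<lparr>Src = comp_functor J K (Src \<eta>), Tgt = comp_functor J K (Tgt \<eta>),
           Cmpt = (\<lambda>x\<in>Obj J. farr K (Cmpt \<eta> x))\<rparr>"
proof -
  have S: "is_functor J C (Src \<eta>)" and T: "is_functor J C (Tgt \<eta>)"
    using e by (auto simp: is_nat_trans_def)
  then have J: "is_category J" by (simp add: is_functor_def)
  have "Comp D (farr K (farr (Tgt \<eta>) f)) (farr K (Cmpt \<eta> (Dom J f))) =
        Comp D (farr K (Cmpt \<eta> (Cod J f))) (farr K (farr (Src \<eta>) f))" if f: "f \<in> Arr J" for f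
  proof -
    note f' = Arr_hom[OF f]
    have x: "Dom J f \<in> Obj J" and y: "Cod J f \<in> Obj J"
      using f J by (auto simp: category_Dom category_Cod)
    show ?thesis
      using functor_Comp[OF K nat_trans_Cmpt[OF e x] functor_farr[OF T f']]
        functor_Comp[OF K functor_farr[OF S f'] nat_trans_Cmpt[OF e y]]
        nat_trans_natural[OF e f'] by simp
  qed
  moreover have "farr K (Cmpt \<eta> x) \<in> hom D (fobj K (fobj (Src \<eta>) x)) (fobj K (fobj (Tgt \<eta>) x))"
    if "x \<in> Obj J" for x
    using functor_farr[OF K nat_trans_Cmpt[OF e that]] .
  ultimately show ?thesis
    using is_functor_comp_functor[OF K S] is_functor_comp_functor[OF K T] J
    by (simp add: is_nat_trans_def comp_functor_def category_Dom category_Cod)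
qed

text \<open>This is the common core of the persistent and the cumulative case: \<open>P\<close> and
  \<open>Q\<close> become the (co)sheaf conditions over \<open>C\<close> and \<open>D\<close>, and
  \<open>PQ\<close> is the only place where preservation of (co)limits will enter.\<close>

lemma is_functor_postcomp:
  assumes J: "is_category J" and K: "is_functor C D K"
    and PQ: "\<And>F. is_functor J C F \<Longrightarrow> P F \<Longrightarrow> Q (comp_functor J K F)"
  shows "is_functor (functor_cat J C P) (functor_cat J D Q) (postcomp J K (functor_cat J C P))"
proof -
  let ?M = "functor_cat J C P" and ?N = "functor_cat J D Q"
  let ?K = "postcomp J K ?M"
  have C: "is_category C" and D: "is_category D"
    using K by (auto simp: is_functor_def)
  note M = is_category_functor_cat[OF J C, of P] and N = is_category_functor_cat[OF J D, of Q]
  have obj: "comp_functor J K F \<in> Obj ?N" if "F \<in> Obj ?M" for F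
    using that is_functor_comp_functor[OF K] PQ by (auto simp: functor_cat_def)
  have arr: "farr ?K \<eta> \<in> hom ?N (fobj ?K (Dom ?M \<eta>)) (fobj ?K (Cod ?M \<eta>))" if "\<eta> \<in> Arr ?M" for \<eta>
  proof -
    have e: "is_nat_trans J C \<eta>" and P: "P (Src \<eta>)" "P (Tgt \<eta>)"
      using that by (auto simp: functor_cat_def)
    then have F: "is_functor J C (Src \<eta>)" "is_functor J C (Tgt \<eta>)"
      by (auto simp: is_nat_trans_def)
    show ?thesis
      using is_nat_trans_whisker[OF K e] e P F PQ[OF F(1)] PQ[OF F(2)]
      by (simp add: functor_cat_def hom_def postcomp_def)
  qed
  have idt: "farr ?K (Idt ?M F) = Idt ?N (fobj ?K F)" if "F \<in> Obj ?M" for F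
  proof -
    have F: "is_functor J C F" using that by (simp add: functor_cat_def)
    have "Idt ?M F \<in> Arr ?M" using category_Idt[OF M that] by (simp add: hom_def)
    \<comment> \<open>Inside \<open>Obj J\<close> this is preservation of identities by
      \<open>K\<close>; outside, both sides are \<open>undefined\<close>.\<close>
    moreover have "(\<lambda>x\<in>Obj J. farr K (Cmpt (Idt ?M F) x)) = Cmpt (Idt ?N (comp_functor J K F))"
      by (rule ext) (simp add: functor_cat_def comp_functor_def functor_Idt[OF K] functor_fobj[OF F])
    ultimately show ?thesis
      using that by (simp add: postcomp_def) (simp add: functor_cat_def)
  qed
  have comp: "farr ?K (Comp ?M \<theta> \<eta>) = Comp ?N (farr ?K \<theta>) (farr ?K \<eta>)"
    if e: "\<eta> \<in> Arr ?M" and t: "\<theta> \<in> Arr ?M" and eq: "Cod ?M \<eta> = Dom ?M \<theta>" for \<eta> \<theta>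
  proof -
    have e': "is_nat_trans J C \<eta>" and t': "is_nat_trans J C \<theta>" and eq': "Tgt \<eta> = Src \<theta>"
      using e t eq by (auto simp: functor_cat_def)
    have "Comp ?M \<theta> \<eta> \<in> Arr ?M"
      using category_Comp[OF M Arr_hom[OF e], of \<theta> "Cod ?M \<theta>"] t eq by (simp add: hom_def)
    moreover have "farr K (Comp C (Cmpt \<theta> x) (Cmpt \<eta> x)) =
        Comp D (farr K (Cmpt \<theta> x)) (farr K (Cmpt \<eta> x))" if "x \<in> Obj J" for x
      using functor_Comp[OF K nat_trans_Cmpt[OF e' that, unfolded eq'] nat_trans_Cmpt[OF t' that]] .
    ultimately show ?thesis
      using e t by (simp add: postcomp_def) (auto simp: functor_cat_def intro!: restrict_ext)
  qed
  have "fobj ?K \<in> Obj ?M \<rightarrow>\<^sub>E Obj ?N"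
    using obj by (simp add: postcomp_def)
  moreover have "farr ?K \<in> Arr ?M \<rightarrow>\<^sub>E Arr ?N"
  proof
    show "farr ?K \<eta> \<in> Arr ?N" if "\<eta> \<in> Arr ?M" for \<eta>
      using arr[OF that] by (simp add: hom_def)
  qed (simp add: postcomp_def)
  ultimately show ?thesis
    unfolding is_functor_def using M N arr idt comp by blast
qed

section \<open>Pullbacks as limits over the cospan category\<close>

text \<open>For injective \<open>e\<close>, the cospan \<open>e 0 \<rightarrow> e 2 \<leftarrow> e 1\<close> with arrows \<open>e 3\<close> and \<open>e 4\<close>; the
  identities of \<open>e 0, e 1, e 2\<close> are these elements themselves.\<close>

definition cospan_cat :: "(nat \<Rightarrow> 'u) \<Rightarrow> ('u, 'u) cat" where
  "cospan_cat e = \<lparr>Obj = {e 0, e 1, e 2}, Arr = {e 0, e 1, e 2, e 3, e 4},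
     Dom = (\<lambda>m. if m = e 3 then e 0 else if m = e 4 then e 1 else m),
     Cod = (\<lambda>m. if m = e 3 \<or> m = e 4 then e 2 else m),
     Idt = (\<lambda>x. x),
     Comp = (\<lambda>g f. if f = e 3 \<or> f = e 4 then f else g)\<rparr>"

text \<open>The final branches are the values at \<open>e 2\<close> and at the arrow
  \<open>e 4\<close>. Since \<open>e 2\<close> is sent to \<open>Cod C f\<close>, this is a diagram
  only for \<open>Cod C f = Cod C g\<close>.\<close>

definition cospan_diagram ::
  "(nat \<Rightarrow> 'u) \<Rightarrow> ('o, 'm) cat \<Rightarrow> 'm \<Rightarrow> 'm \<Rightarrow> ('u, 'u, 'o, 'm) functr" where
  "cospan_diagram e C f g =
     \<lparr>fobj = (\<lambda>j\<in>Obj (cospan_cat e).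
        if j = e 0 then Dom C f else if j = e 1 then Dom C g else Cod C f),
      farr = (\<lambda>m\<in>Arr (cospan_cat e).
        if m = e 0 then Idt C (Dom C f) else if m = e 1 then Idt C (Dom C g)
        else if m = e 2 then Idt C (Cod C f) else if m = e 3 then f else g)\<rparr>"

text \<open>Every composable pair contains an identity, because \<open>e 3\<close> and
  \<open>e 4\<close> both end at \<open>e 2\<close>, where only the identity starts;
  \<open>Comp\<close> returns the other member of the pair. Injectivity of \<open>e\<close> keeps
  the five arrows apart.\<close>

lemma is_category_cospan_cat:
  assumes "inj e"
  shows "is_category (cospan_cat e)"
  unfolding is_category_def cospan_cat_def hom_def by (auto simp: inj_eq[OF assms])

lemma is_functor_cospan_diagram:
  assumes e: "inj e" and C: "is_category C"
    and fg: "f \<in> Arr C" "g \<in> Arr C" "Cod C f = Cod C g"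
  shows "is_functor (cospan_cat e) C (cospan_diagram e C f g)"
proof -
  have obj: "Dom C f \<in> Obj C" "Dom C g \<in> Obj C" "Cod C g \<in> Obj C"
    using C fg by (auto simp: category_Dom category_Cod)
  note idt = obj[THEN category_Idt[OF C]]
  note unit = category_Comp_Idt[OF C Arr_hom[OF fg(1)]] category_Comp_Idt[OF C Arr_hom[OF fg(2)]]
    category_Idt_Comp[OF C Arr_hom[OF fg(1)]] category_Idt_Comp[OF C Arr_hom[OF fg(2)]]
    idt[THEN category_Comp_Idt[OF C]]
  show ?thesis
    unfolding is_functor_def
    using is_category_cospan_cat[OF e] C fg obj idt unit
    by (auto simp: cospan_diagram_def cospan_cat_def hom_def inj_eq[OF e])
qed

text \<open>Continuity yields a limit of the composite diagram; this equation turns it into the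
  limit of a cospan in \<open>D\<close>, to which the characterization of pullbacks applies
  again.\<close>

lemma comp_functor_cospan_diagram:
  assumes e: "inj e" and K: "is_functor C D K" and f: "f \<in> Arr C" and g: "g \<in> Arr C"
  shows "comp_functor (cospan_cat e) K (cospan_diagram e C f g) =
         cospan_diagram e D (farr K f) (farr K g)"
proof -
  have C: "is_category C" using K by (simp add: is_functor_def)
  have "Dom C f \<in> Obj C" "Dom C g \<in> Obj C" "Cod C f \<in> Obj C"
    using C f g by (auto simp: category_Dom category_Cod)
  then show ?thesis
    using functor_farr[OF K Arr_hom[OF f]] functor_farr[OF K Arr_hom[OF g]]
    by (auto simp: comp_functor_def cospan_diagram_def cospan_cat_def hom_def inj_eq[OF e]
        functor_Idt[OF K] intro!: restrict_ext)
qed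

section \<open>Limit cones over a cospan and pullback squares\<close>

lemma cone_cospan_iff:
  assumes e: "inj e" and C: "is_category C"
    and fg: "f \<in> Arr C" "g \<in> Arr C" "Cod C f = Cod C g"
  shows "cone (cospan_cat e) C (cospan_diagram e C f g) x l \<longleftrightarrow>
    l (e 0) \<in> hom C x (Dom C f) \<and> l (e 1) \<in> hom C x (Dom C g) \<and>
    Comp C f (l (e 0)) = l (e 2) \<and> Comp C g (l (e 1)) = l (e 2)"
    (is "?L \<longleftrightarrow> ?R")
proof
  assume ?L
  then show ?R
    by (simp add: cone_def cospan_cat_def cospan_diagram_def inj_eq[OF e])
next
  assume R: ?R
  have f: "f \<in> hom C (Dom C f) (Cod C f)" using fg by (simp add: hom_def)
  have "x \<in> Obj C" using R category_Dom[OF C] by (auto simp: hom_def)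
  \<comment> \<open>The leg at \<open>e 2\<close> is the composite of \<open>f\<close> with the leg
    at \<open>e 0\<close>, which fixes its type; the cone equations at the three identities are then
    unit laws.\<close>
  moreover have l2: "l (e 2) \<in> hom C x (Cod C f)"
    using category_Comp[OF C _ f] R by metis
  ultimately show ?L
    using R by (auto simp: cone_def cospan_cat_def cospan_diagram_def inj_eq[OF e]
        intro: category_Idt_Comp[OF C])
qed

text \<open>A commuting square becomes a cone by adding its diagonal \<open>Comp C f p\<close> as
  the leg at \<open>e 2\<close>, and both universal properties ask for the same mediating
  arrow.\<close>

lemma pullback_imp_limit_cone:
  assumes e: "inj e" and C: "is_category C" and pb: "is_pullback C p q f g"
  shows "limit_cone (cospan_cat e) C (cospan_diagram e C f g) (Dom C p)
           (\<lambda>j. if j = e 0 then p else if j = e 1 then q else Comp C f p)"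
    (is "limit_cone _ _ ?G _ ?l")
proof -
  have fg: "f \<in> Arr C" "g \<in> Arr C" "Cod C f = Cod C g"
    and p: "p \<in> hom C (Dom C p) (Dom C f)" and q: "q \<in> hom C (Dom C p) (Dom C g)"
    and eq: "Comp C f p = Comp C g q"
    using pb by (auto simp: is_pullback_def hom_def)
  note f = Arr_hom[OF fg(1)]
  note cone = cone_cospan_iff[OF e C fg]
  have "\<exists>!h. h \<in> hom C x (Dom C p) \<and> (\<forall>j\<in>Obj (cospan_cat e). Comp C (?l j) h = k j)"
    if k: "cone (cospan_cat e) C ?G x k" for x k
  proof -
    have x: "x \<in> Obj C" using k by (simp add: cone_def)
    have k': "k (e 0) \<in> hom C x (Dom C f)" "k (e 1) \<in> hom C x (Dom C g)"
      "Comp C f (k (e 0)) = k (e 2)" "Comp C f (k (e 0)) = Comp C g (k (e 1))"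
      using k by (auto simp: cone)
    \<comment> \<open>The equation at \<open>e 2\<close> follows from the one at \<open>e 0\<close>
      by composing with \<open>f\<close>.\<close>
    have "(\<forall>j\<in>Obj (cospan_cat e). Comp C (?l j) h = k j) \<longleftrightarrow>
        Comp C p h = k (e 0) \<and> Comp C q h = k (e 1)" if "h \<in> hom C x (Dom C p)" for h
      using category_assoc[OF C that p f] k'(3)
      by (auto simp: cospan_cat_def inj_eq[OF e])
    moreover have "\<exists>!h. h \<in> hom C x (Dom C p) \<and> Comp C p h = k (e 0) \<and> Comp C q h = k (e 1)"
      using pb x k' unfolding is_pullback_def by blast
    ultimately show ?thesis
      by (metis (no_types, lifting))
  qed
  moreover have "cone (cospan_cat e) C ?G (Dom C p) ?l"
    using p q eq by (simp add: cone inj_eq[OF e])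
  ultimately show ?thesis
    by (simp add: limit_cone_def)
qed

text \<open>The legs at \<open>e 0\<close> and \<open>e 1\<close> serve as projections. The limit
  cone is arbitrary so that the image under a functor of a limit cone can be used.\<close>

lemma limit_cone_imp_pullback:
  assumes e: "inj e" and C: "is_category C"
    and fg: "f \<in> Arr C" "g \<in> Arr C" "Cod C f = Cod C g"
    and lim: "limit_cone (cospan_cat e) C (cospan_diagram e C f g) c l"
  shows "is_pullback C (l (e 0)) (l (e 1)) f g"
proof -
  let ?G = "cospan_diagram e C f g"
  note cone = cone_cospan_iff[OF e C fg]
  note f = Arr_hom[OF fg(1)]
  have l: "l (e 0) \<in> hom C c (Dom C f)" "l (e 1) \<in> hom C c (Dom C g)"
    "Comp C f (l (e 0)) = l (e 2)" "Comp C g (l (e 1)) = l (e 2)"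
    using lim by (auto simp: limit_cone_def cone)
  have "\<exists>!h. h \<in> hom C x c \<and> Comp C (l (e 0)) h = p' \<and> Comp C (l (e 1)) h = q'"
    if p': "p' \<in> hom C x (Dom C f)" and q': "q' \<in> hom C x (Dom C g)"
      and eq: "Comp C f p' = Comp C g q'" for x p' q'
  proof -
    \<comment> \<open>The competing square is completed to a cone by its diagonal.\<close>
    let ?k = "\<lambda>j. if j = e 0 then p' else if j = e 1 then q' else Comp C f p'"
    have "cone (cospan_cat e) C ?G x ?k"
      using p' q' eq by (simp add: cone inj_eq[OF e])
    then have "\<exists>!h. h \<in> hom C x c \<and> (\<forall>j\<in>Obj (cospan_cat e). Comp C (l j) h = ?k j)"
      using lim unfolding limit_cone_def by blast
    moreover have "(\<forall>j\<in>Obj (cospan_cat e). Comp C (l j) h = ?k j) \<longleftrightarrow>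
        Comp C (l (e 0)) h = p' \<and> Comp C (l (e 1)) h = q'" if "h \<in> hom C x c" for h
      using category_assoc[OF C that l(1) f] l(3)
      by (auto simp: cospan_cat_def inj_eq[OF e])
    ultimately show ?thesis
      by (metis (no_types, lifting))
  qed
  moreover have "l (e 0) \<in> Arr C" "l (e 1) \<in> Arr C" "Dom C (l (e 0)) = c" "Dom C (l (e 1)) = c"
    "Cod C (l (e 0)) = Dom C f" "Cod C (l (e 1)) = Dom C g"
    using l by (auto simp: hom_def)
  ultimately show ?thesis
    using l(3,4) fg unfolding is_pullback_def by simp
qed

lemma continuous_functor_pullback:
  fixes C :: "('oc, 'mc) cat" and D :: "('od, 'md) cat"
  assumes cont: "continuous_functor TYPE('u::infinite) C D K" and pb: "is_pullback C p q f g"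
  shows "is_pullback D (farr K p) (farr K q) (farr K f) (farr K g)"
proof -
  \<comment> \<open>An infinite type contains a sequence without repetitions, so the cospan category
    has a copy among the shapes over \<open>'u\<close> that continuity quantifies over.\<close>
  obtain e :: "nat \<Rightarrow> 'u" where e: "inj e"
    using infinite_countable_subset[OF infinite_UNIV] by blast
  have K: "is_functor C D K" using cont by (simp add: continuous_functor_def)
  then have C: "is_category C" and D: "is_category D" by (auto simp: is_functor_def)
  have fg: "f \<in> Arr C" "g \<in> Arr C" "Cod C f = Cod C g"
    using pb by (auto simp: is_pullback_def)
  let ?l = "\<lambda>j. if j = e 0 then p else if j = e 1 then q else Comp C f p"
  have "limit_cone (cospan_cat e) D (comp_functor (cospan_cat e) K (cospan_diagram e C f g))
          (fobj K (Dom C p)) (\<lambda>j. farr K (?l j))"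
    using cont is_functor_cospan_diagram[OF e C fg] pullback_imp_limit_cone[OF e C pb]
    unfolding continuous_functor_def by blast
  then have "limit_cone (cospan_cat e) D (cospan_diagram e D (farr K f) (farr K g))
          (fobj K (Dom C p)) (\<lambda>j. farr K (?l j))"
    by (simp add: comp_functor_cospan_diagram[OF e K fg(1,2)])
  moreover have "farr K f \<in> Arr D" "farr K g \<in> Arr D" "Cod D (farr K f) = Cod D (farr K g)"
    using functor_farr[OF K Arr_hom[OF fg(1)]] functor_farr[OF K Arr_hom[OF fg(2)]] fg(3)
    by (auto simp: hom_def)
  ultimately show ?thesis
    \<comment> \<open>At \<open>e 0\<close> and \<open>e 1\<close> the legs of the image cone are
      \<open>farr K p\<close> and \<open>farr K q\<close>.\<close>
    using limit_cone_imp_pullback[OF e D] by (fastforce simp: inj_eq[OF e])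
qed

section \<open>Duality\<close>

lemma op_cat_sel [simp]:
  "Obj (op_cat C) = Obj C" "Arr (op_cat C) = Arr C" "Dom (op_cat C) = Cod C"
  "Cod (op_cat C) = Dom C" "Idt (op_cat C) = Idt C" "Comp (op_cat C) g f = Comp C f g"
  "hom (op_cat C) x y = hom C y x"
  by (auto simp: op_cat_def hom_def)

lemma op_cat_op_cat [simp]: "op_cat (op_cat C) = C"
  by (simp add: op_cat_def)

lemma is_category_op_cat: "is_category C \<Longrightarrow> is_category (op_cat C)"
  by (simp add: is_category_def)

lemma is_functor_op_cat: "is_functor C D F \<Longrightarrow> is_functor (op_cat C) (op_cat D) F"
  by (auto simp: is_functor_def is_category_op_cat)

text \<open>The shape is reversed along with \<open>C\<close>: with unchanged object and arrow maps,
  a diagram of shape \<open>J\<close> in \<open>C\<close> is one of shape \<open>op_cat J\<close> in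
  \<open>op_cat C\<close>.\<close>

lemma limit_cone_op_cat: "limit_cone (op_cat J) (op_cat C) G c l = colimit_cocone J C G c l"
  by (simp add: limit_cone_def colimit_cocone_def cone_def cocone_def)

lemma is_pullback_op_cat: "is_pullback (op_cat C) i j f g = is_pushout C i j f g"
  by (auto simp: is_pullback_def is_pushout_def)

lemma comp_functor_op_cat: "comp_functor (op_cat J) K F = comp_functor J K F"
  by (simp add: comp_functor_def)

text \<open>Reversing a shape leaves its types alone, so shapes over \<open>'u\<close> are closed
  under \<open>op_cat\<close>, and continuity at \<open>J\<close> is cocontinuity at
  \<open>op_cat J\<close>.\<close>

lemma continuous_functor_op_cat:
  fixes C :: "('oc, 'mc) cat" and D :: "('od, 'md) cat"
  assumes "cocontinuous_functor TYPE('u::infinite) C D K"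
  shows "continuous_functor TYPE('u) (op_cat C) (op_cat D) K"
  unfolding continuous_functor_def
proof (intro conjI allI impI)
  show "is_functor (op_cat C) (op_cat D) K"
    using assms by (simp add: cocontinuous_functor_def is_functor_op_cat)
next
  fix J :: "('u, 'u) cat" and G c l
  assume "is_functor J (op_cat C) G" and "limit_cone J (op_cat C) G c l"
  then have "is_functor (op_cat J) C G" and "colimit_cocone (op_cat J) C G c l"
    using is_functor_op_cat[of J "op_cat C" G] limit_cone_op_cat[of "op_cat J" C G c l] by auto
  then have "colimit_cocone (op_cat J) D (comp_functor (op_cat J) K G) (fobj K c) (\<lambda>j. farr K (l j))"
    using assms unfolding cocontinuous_functor_def by blast
  then show "limit_cone J (op_cat D) (comp_functor J K G) (fobj K c) (\<lambda>j. farr K (l j))"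
    using limit_cone_op_cat[of "op_cat J" D] by (simp add: comp_functor_op_cat)
qed

lemma cocontinuous_functor_pushout:
  fixes C :: "('oc, 'mc) cat" and D :: "('od, 'md) cat"
  assumes "cocontinuous_functor TYPE('u::infinite) C D K" and "is_pushout C i j f g"
  shows "is_pushout D (farr K i) (farr K j) (farr K f) (farr K g)"
  using continuous_functor_pullback[OF continuous_functor_op_cat[OF assms(1)]] assms(2)
  by (simp add: is_pullback_op_cat)

section \<open>Narratives\<close>

lemma is_category_poset_cat: "is_category (poset_cat T)"
  by (auto simp: is_category_def poset_cat_def hom_def)

text \<open>These memberships allow the restricted arrow map of \<open>comp_functor\<close> to be
  evaluated at the four inclusions of a cover. They serve sheaves too, as \<open>op_cat\<close> has
  the same arrows.\<close>

lemma cover_Arr: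
  assumes "cover A T a p b"
  shows "(ivl A a p, ivl A a b) \<in> Arr (poset_cat T)" "(ivl A p b, ivl A a b) \<in> Arr (poset_cat T)"
    "(ivl A p p, ivl A a p) \<in> Arr (poset_cat T)" "(ivl A p p, ivl A p b) \<in> Arr (poset_cat T)"
  using assms by (auto simp: cover_def poset_cat_def ivl_def)

text \<open>At each cover, the square of the composite is \<open>K\<close> applied to the square of
  \<open>F\<close>, and a continuous \<open>K\<close> preserves that pullback.\<close>

lemma is_sheaf_comp_functor:
  assumes cont: "continuous_functor TYPE('u::infinite) C D K" and F: "is_sheaf A T C F"
  shows "is_sheaf A T D (comp_functor (op_cat (poset_cat T)) K F)"
proof -
  have "is_functor C D K" using cont by (simp add: continuous_functor_def)
  moreover have "is_functor (op_cat (poset_cat T)) C F"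
    using F by (simp add: is_sheaf_def)
  ultimately have "is_functor (op_cat (poset_cat T)) D (comp_functor (op_cat (poset_cat T)) K F)"
    by (rule is_functor_comp_functor)
  then show ?thesis
    using F continuous_functor_pullback[OF cont]
    by (simp add: is_sheaf_def) (simp add: comp_functor_def cover_Arr)
qed

lemma is_cosheaf_comp_functor:
  assumes cocont: "cocontinuous_functor TYPE('u::infinite) C D K" and F: "is_cosheaf A T C F"
  shows "is_cosheaf A T D (comp_functor (poset_cat T) K F)"
proof -
  have "is_functor C D K" using cocont by (simp add: cocontinuous_functor_def)
  moreover have "is_functor (poset_cat T) C F"
    using F by (simp add: is_cosheaf_def)
  ultimately have "is_functor (poset_cat T) D (comp_functor (poset_cat T) K F)"
    by (rule is_functor_comp_functor)
  then show ?thesis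
    using F cocontinuous_functor_pushout[OF cocont]
    by (simp add: is_cosheaf_def) (simp add: comp_functor_def cover_Arr)
qed

theorem proposition2p15:
  fixes C :: "('oc, 'mc) cat" and D :: "('od, 'md) cat"
    and K :: "('oc, 'mc, 'od, 'md) functr"
    and A :: "real set" and T :: "real set set"
  assumes "is_category C" and "is_category D" and "time_category A T"
  shows
    "(has_limits TYPE('u::infinite) C \<and> has_limits TYPE('u) D \<and>
        continuous_functor TYPE('u) C D K \<longrightarrow>
      is_functor (Pe A T C) (Pe A T D) (postcomp (op_cat (poset_cat T)) K (Pe A T C))) \<and>
     (has_colimits TYPE('u) C \<and> has_colimits TYPE('u) D \<and>
        cocontinuous_functor TYPE('u) C D K \<longrightarrow>
      is_functor (Cu A T C) (Cu A T D) (postcomp (poset_cat T) K (Cu A T C)))"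
proof (intro conjI impI; elim conjE)
  assume cont: "continuous_functor TYPE('u) C D K"
  show "is_functor (Pe A T C) (Pe A T D) (postcomp (op_cat (poset_cat T)) K (Pe A T C))"
    \<comment> \<open>\<open>is_functor_postcomp\<close> applies with \<open>is_sheaf\<close> over
      \<open>C\<close> and over \<open>D\<close> as the two predicates; its closure hypothesis is
      \<open>is_sheaf_comp_functor\<close>.\<close>
    unfolding Pe_def
    using cont is_sheaf_comp_functor[OF cont]
    by (intro is_functor_postcomp is_category_op_cat is_category_poset_cat)
      (auto simp: continuous_functor_def)
next
  assume cocont: "cocontinuous_functor TYPE('u) C D K"
  show "is_functor (Cu A T C) (Cu A T D) (postcomp (poset_cat T) K (Cu A T C))"
    unfolding Cu_def
    using cocont is_cosheaf_comp_functor[OF cocont]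
    by (intro is_functor_postcomp is_category_poset_cat)
      (auto simp: cocontinuous_functor_def)
qed

end
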